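(* Let $d,n,k\ge 1$. The group $\mathrm{RTM}(\mathbb{Z}^d,n,k)$ admits a recursive presentation with decidable word problem.
   Context: Let $\Sigma=\{0,\dots,n-1\}$ (tape symbols), $Q=\{1,\dots,k\}$ (states). The shift on $\Sigma^{\mathbb{Z}^d}$ is $(\sigma^{v}(x))_{u}=x_{u-v}$. A moving head $(\mathbb{Z}^d,n,k)$-Turing machine is a map $T:\Sigma^{\mathbb{Z}^d}\times Q\times\mathbb{Z}^d\to\Sigma^{\mathbb{Z}^d}\times Q\times\mathbb{Z}^d$ (a triple is tape, state, head position) for which there are finite sets $F_{\rm in},F_{\rm out}\subset\mathbb{Z}^d$ and a function $f:\Sigma^{F_{\rm in}}\times Q\to\Sigma^{F_{\rm out}}\times Q\times\mathbb{Z}^d$ such that $T(x,q,v)=(\tilde x,\tilde q,v+\tilde u)$, where $(\tilde p,\tilde q,\tilde u)=f(\sigma^{-v}(x)|_{F_{\rm in}},q)$, and $\tilde x_{u}=\tilde p_{u-v}$ if $u-v\in F_{\rm out}$, $\tilde x_u=x_u$ otherwise. $T$ is reversible if there is a $(\mathbb{Z}^d,n,k)$-Turing machine $T^{-1}$ with $T\circ T^{-1}=T^{-1}\circ T=\mathrm{id}$. $\mathrm{RTM}(\mathbb{Z}^d,n,k)$ is the group of reversible machines under composition. Recursive presentation here allows a countably infinite, recursively enumerated set of generators, with a recursively enumerable set of relations; the word problem is the set of words in the generators that represent the identity. *)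

theory Defs
  imports
    "HOL-Algebra.Bij"
    "HOL-Analysis.Finite_Cartesian_Product"
    "HOL-Library.Nat_Bijection"
begin

section \<open>Recursive functions and sets\<close>

text \<open>
  Total recursive functions in Kleene's sense: an \<open>m\<close>-ary function is represented by a function
  on lists whose values on lists of length other than \<open>m\<close> are irrelevant (rule \<open>ext\<close>).
  Minimization is applied to regular functions only, so that all functions stay total.
\<close>

inductive recursive_fn :: "nat \<Rightarrow> (nat list \<Rightarrow> nat) \<Rightarrow> bool" where
  zero: "recursive_fn m (\<lambda>xs. 0)"
| succ: "recursive_fn 1 (\<lambda>xs. Suc (xs ! 0))"
| proj: "i < m \<Longrightarrow> recursive_fn m (\<lambda>xs. xs ! i)"
| comp: "recursive_fn (length gs) f \<Longrightarrow> \<forall>g \<in> set gs. recursive_fn m g \<Longrightarrow>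
    recursive_fn m (\<lambda>xs. f (map (\<lambda>g. g xs) gs))"
| prim_rec: "recursive_fn m f \<Longrightarrow> recursive_fn (Suc (Suc m)) g \<Longrightarrow>
    recursive_fn (Suc m) (\<lambda>xs. rec_nat (f (tl xs)) (\<lambda>y r. g (y # r # tl xs)) (hd xs))"
| minim: "recursive_fn (Suc m) f \<Longrightarrow> \<forall>xs. length xs = m \<longrightarrow> (\<exists>y. f (y # xs) = 0) \<Longrightarrow>
    recursive_fn m (\<lambda>xs. LEAST y. f (y # xs) = 0)"
| ext: "recursive_fn m f \<Longrightarrow> \<forall>xs. length xs = m \<longrightarrow> g xs = f xs \<Longrightarrow> recursive_fn m g"

definition recursive_set :: "nat set \<Rightarrow> bool" where
  "recursive_set A \<longleftrightarrow> recursive_fn 1 (\<lambda>xs. if xs ! 0 \<in> A then 1 else 0)"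

definition re_set :: "nat set \<Rightarrow> bool" where
  "re_set A \<longleftrightarrow> A = {} \<or> (\<exists>f. recursive_fn 1 f \<and> A = range (\<lambda>i. f [i]))"

section \<open>Group presentations on a set of generator symbols numbered by natural numbers\<close>

text \<open>The letter \<open>(s, True)\<close> stands for the generator \<open>s\<close>, and \<open>(s, False)\<close> for its inverse.\<close>

type_synonym word = "(nat \<times> bool) list"

definition words :: "nat set \<Rightarrow> word set" where
  "words S = lists (S \<times> UNIV)"

text \<open>
  Two words are related iff one arises from the other by inserting and deleting relators and
  trivial words \<open>s s\<^sup>-\<^sup>1\<close>, \<open>s\<^sup>-\<^sup>1 s\<close>; the classes are the elements of the presented group, i.e. of
  the free group on \<open>S\<close> modulo the normal closure of \<open>R\<close>.
\<close>

inductive_set pres_rel :: "nat set \<Rightarrow> word set \<Rightarrow> (word \<times> word) set"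
  for S :: "nat set" and R :: "word set" where
  refl: "w \<in> words S \<Longrightarrow> (w, w) \<in> pres_rel S R"
| sym: "(v, w) \<in> pres_rel S R \<Longrightarrow> (w, v) \<in> pres_rel S R"
| trans: "(u, v) \<in> pres_rel S R \<Longrightarrow> (v, w) \<in> pres_rel S R \<Longrightarrow> (u, w) \<in> pres_rel S R"
| cancel: "u \<in> words S \<Longrightarrow> v \<in> words S \<Longrightarrow> s \<in> S \<Longrightarrow>
    (u @ [(s, b), (s, \<not> b)] @ v, u @ v) \<in> pres_rel S R"
| relator: "u \<in> words S \<Longrightarrow> v \<in> words S \<Longrightarrow> r \<in> R \<Longrightarrow> (u @ r @ v, u @ v) \<in> pres_rel S R"

definition presented_group :: "nat set \<Rightarrow> word set \<Rightarrow> word set monoid" where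
  "presented_group S R =
    \<lparr>carrier = words S // pres_rel S R,
     mult = (\<lambda>A B. \<Union>a\<in>A. \<Union>b\<in>B. pres_rel S R `` {a @ b}),
     one = pres_rel S R `` {[]}\<rparr>"

definition word_problem :: "nat set \<Rightarrow> word set \<Rightarrow> word set" where
  "word_problem S R = {w \<in> words S. pres_rel S R `` {w} = \<one>\<^bsub>presented_group S R\<^esub>}"

definition word_code :: "word \<Rightarrow> nat" where
  "word_code w = list_encode (map (\<lambda>(s, b). prod_encode (s, of_bool b)) w)"

definition recursive_presentation :: "nat set \<Rightarrow> word set \<Rightarrow> bool" where
  "recursive_presentation S R \<longleftrightarrow> re_set S \<and> R \<subseteq> words S \<and> re_set (word_code ` R)"

definition decidable_word_problem :: "nat set \<Rightarrow> word set \<Rightarrow> bool" where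
  "decidable_word_problem S R \<longleftrightarrow> recursive_set (word_code ` word_problem S R)"

section \<open>Moving head Turing machines on \<open>\<int>\<^sup>d\<close>\<close>

text \<open>
  The dimension \<open>d\<close> is the cardinality of the index type \<open>'d\<close>, so that \<open>\<int>\<^sup>d\<close> is \<open>int ^ 'd\<close>.
  A configuration is a triple of tape, state and head position.
\<close>

type_synonym 'd tape = "int ^ 'd \<Rightarrow> nat"
type_synonym 'd config = "'d tape \<times> nat \<times> (int ^ 'd)"

definition shift :: "int ^ 'd::finite \<Rightarrow> 'd tape \<Rightarrow> 'd tape" where
  "shift v x = (\<lambda>u. x (u - v))"

definition patterns :: "nat \<Rightarrow> (int ^ 'd::finite) set \<Rightarrow> 'd tape set" where
  "patterns n F = F \<rightarrow>\<^sub>E {..<n}"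

definition configs :: "nat \<Rightarrow> nat \<Rightarrow> 'd::finite config set" where
  "configs n k = patterns n UNIV \<times> {1..k} \<times> UNIV"

text \<open>Machines are maps defined on \<open>configs n k\<close> only, hence \<open>extensional\<close> there.\<close>

definition turing_machines :: "nat \<Rightarrow> nat \<Rightarrow> ('d::finite config \<Rightarrow> 'd config) set" where
  "turing_machines n k =
    {T \<in> configs n k \<rightarrow>\<^sub>E configs n k.
      \<exists>F_in F_out f. finite F_in \<and> finite F_out \<and>
        f \<in> patterns n F_in \<times> {1..k} \<rightarrow> patterns n F_out \<times> {1..k} \<times> UNIV \<and>
        (\<forall>(x, q, v) \<in> configs n k. 
          let (p', q', u') = f (restrict (shift (- v) x) F_in, q)
          in T (x, q, v) = ((\<lambda>u. if u - v \<in> F_out then p' (u - v) else x u), q', v + u'))}"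

definition reversible_machines :: "nat \<Rightarrow> nat \<Rightarrow> ('d::finite config \<Rightarrow> 'd config) set" where
  "reversible_machines n k =
    {T \<in> turing_machines n k. \<exists>T' \<in> turing_machines n k.
      compose (configs n k) T T' = (\<lambda>c \<in> configs n k. c) \<and>
      compose (configs n k) T' T = (\<lambda>c \<in> configs n k. c)}"

definition RTM :: "'d::finite itself \<Rightarrow> nat \<Rightarrow> nat \<Rightarrow> ('d config \<Rightarrow> 'd config) monoid" where
  "RTM _ n k = (BijGroup (configs n k)) \<lparr>carrier := reversible_machines n k\<rparr>"

end

theory Submission
  imports Defs "HOL-Library.More_List"
begin

text \<open>
  A local rule of a Turing machine is a finite object: a list of instructions "in state \<open>q\<close>, on
  reading this finite pattern around the head, write that pattern, enter state \<open>q'\<close> and move by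
  \<open>u\<close>". Such lists, called programs here, can be numbered, and every machine is given by a program
  (\<open>turing_machine_program\<close>). All relations between machines are decidable, for the following
  reason. A product of programs, started with its head at the origin, reads and writes only inside
  a finite set of cells that can be computed from the programs (\<open>run_local\<close>), and it commutes with
  translations. Hence it is the identity if and only if it fixes the finitely many configurations
  with head at the origin whose tape vanishes outside this set, which is verified by
  simulation (\<open>acts_trivially_iff\<close>).

  The generators are all natural numbers. A number codes a pair of programs; if the two programs
  are inverse to each other, which is itself a question about two products being the identity, the
  generator stands for the first of them and its formal inverse for the second. Otherwise the
  generator stands for the identity. In this way every reversible machine is named by a generator and no
  set of valid codes has to be enumerated. The relators are all words that act as the identity.
  Then two words are equivalent if and only if they act in the same way
  (\<open>pres_rel_kernel\<close>), so the presented group is the group of reversible machines and the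
  word problem is the set of relators, which is recursive and a fortiori recursively enumerable.

  The decision procedure is written as an ordinary function on lists, numbers and vectors. That it
  is recursive follows from closure properties of the predicate \<open>computable\<close>, which lifts Kleene's
  recursive functions to types whose elements are coded by numbers.
\<close>

section \<open>Recursive functions of small arity\<close>

definition unary_rec :: "(nat \<Rightarrow> nat) \<Rightarrow> bool" where
  "unary_rec f \<longleftrightarrow> recursive_fn 1 (\<lambda>xs. f (xs ! 0))"

definition binary_rec :: "(nat \<Rightarrow> nat \<Rightarrow> nat) \<Rightarrow> bool" where
  "binary_rec f \<longleftrightarrow> recursive_fn 2 (\<lambda>xs. f (xs ! 0) (xs ! 1))"

lemma recursive_fn_comp1:
  assumes "unary_rec F" "recursive_fn m f"
  shows "recursive_fn m (\<lambda>xs. F (f xs))"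
  using recursive_fn.comp[of "[f]" "\<lambda>xs. F (xs ! 0)" m] assms by (simp add: unary_rec_def)

lemma recursive_fn_comp2:
  assumes "binary_rec F" "recursive_fn m f" "recursive_fn m g"
  shows "recursive_fn m (\<lambda>xs. F (f xs) (g xs))"
  using recursive_fn.comp[of "[f, g]" "\<lambda>xs. F (xs ! 0) (xs ! 1)" m] assms
  by (simp add: binary_rec_def numeral_2_eq_2)

lemma recursive_fn_const: "recursive_fn m (\<lambda>xs. c)"
proof (induction c)
  case (Suc c)
  then show ?case
    using recursive_fn_comp1[of Suc m] recursive_fn.succ by (simp add: unary_rec_def)
qed (rule recursive_fn.zero)

lemma unary_rec_const: "unary_rec (\<lambda>x. c)"
  by (simp add: unary_rec_def recursive_fn_const)

lemma unary_rec_id: "unary_rec (\<lambda>x. x)"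
  by (simp add: unary_rec_def recursive_fn.proj)

lemma unary_rec_Suc: "unary_rec Suc"
  using recursive_fn.succ by (simp add: unary_rec_def)

lemma unary_rec_comp1: "unary_rec F \<Longrightarrow> unary_rec f \<Longrightarrow> unary_rec (\<lambda>x. F (f x))"
  unfolding unary_rec_def[of f] unary_rec_def[of "\<lambda>x. F (f x)"] by (rule recursive_fn_comp1)

lemma unary_rec_comp2:
  "binary_rec F \<Longrightarrow> unary_rec f \<Longrightarrow> unary_rec g \<Longrightarrow> unary_rec (\<lambda>x. F (f x) (g x))"
  unfolding unary_rec_def by (rule recursive_fn_comp2)

lemma binary_rec_const: "binary_rec (\<lambda>x y. c)"
  by (simp add: binary_rec_def recursive_fn_const)

lemma binary_rec_fst: "binary_rec (\<lambda>x y. x)" and binary_rec_snd: "binary_rec (\<lambda>x y. y)"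
  by (simp_all add: binary_rec_def recursive_fn.proj)

lemma binary_rec_comp1: "unary_rec F \<Longrightarrow> binary_rec f \<Longrightarrow> binary_rec (\<lambda>x y. F (f x y))"
  unfolding binary_rec_def by (rule recursive_fn_comp1)

lemma binary_rec_comp2:
  "binary_rec F \<Longrightarrow> binary_rec f \<Longrightarrow> binary_rec g \<Longrightarrow> binary_rec (\<lambda>x y. F (f x y) (g x y))"
  unfolding binary_rec_def[of f] binary_rec_def[of g] binary_rec_def[of "\<lambda>x y. F (f x y) (g x y)"]
  by (rule recursive_fn_comp2)

text \<open>
  Primitive recursion with a single parameter \<open>z\<close> is enough, since several parameters can be coded
  into one number once pairing is available.
\<close>

lemma binary_rec_prim_rec:
  assumes "unary_rec a" and "recursive_fn 3 (\<lambda>xs. h (xs ! 0) (xs ! 1) (xs ! 2))"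
  shows "binary_rec (\<lambda>n z. rec_nat (a z) (\<lambda>y r. h y r z) n)"
proof -
  have "recursive_fn (Suc 1) (\<lambda>xs. rec_nat (a (tl xs ! 0))
      (\<lambda>y r. (\<lambda>xs. h (xs ! 0) (xs ! 1) (xs ! 2)) (y # r # tl xs)) (hd xs))"
    using assms by (intro recursive_fn.prim_rec) (simp_all add: unary_rec_def numeral_3_eq_3)
  then show ?thesis
    unfolding binary_rec_def numeral_2_eq_2
    unfolding One_nat_def
    by (rule recursive_fn.ext) (auto simp: length_Suc_conv numeral_2_eq_2)
qed

lemma recursive_fn_3_last:
  assumes "binary_rec f"
  shows "recursive_fn 3 (\<lambda>xs. f (xs ! 1) (xs ! 2))"
  by (intro recursive_fn_comp2[OF assms] recursive_fn.proj) simp_all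

lemma binary_rec_add: "binary_rec (+)"
proof -
  have "binary_rec (\<lambda>n z. rec_nat z (\<lambda>y r. Suc r) n)"
    by (intro binary_rec_prim_rec unary_rec_id recursive_fn_comp1[OF unary_rec_Suc]
        recursive_fn.proj) simp
  moreover have "rec_nat z (\<lambda>y r. Suc r) n = n + z" for n z by (induction n) auto
  ultimately show ?thesis by simp
qed

lemma unary_rec_pred: "unary_rec (\<lambda>n. n - 1)"
proof -
  have "binary_rec (\<lambda>n z. rec_nat 0 (\<lambda>y r. y) n)"
    by (intro binary_rec_prim_rec unary_rec_const recursive_fn.proj) simp
  then have "unary_rec (\<lambda>n. rec_nat 0 (\<lambda>y r. y) n)"
    by (rule unary_rec_comp2[OF _ unary_rec_id unary_rec_id])
  moreover have "rec_nat 0 (\<lambda>y r. y) n = n - 1" for n :: nat by (cases n) auto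
  ultimately show ?thesis by simp
qed

lemma binary_rec_diff: "binary_rec (-)"
proof -
  have "binary_rec (\<lambda>n z. rec_nat z (\<lambda>y r. r - 1) n)"
    by (intro binary_rec_prim_rec unary_rec_id recursive_fn_comp1[OF unary_rec_pred]
        recursive_fn.proj) simp
  moreover have "rec_nat z (\<lambda>y r. r - 1) n = z - n" for n z :: nat by (induction n) auto
  ultimately have "binary_rec (\<lambda>n z. z - n)" by simp
  from binary_rec_comp2[OF this binary_rec_snd binary_rec_fst] show ?thesis by simp
qed

lemma binary_rec_mult: "binary_rec (*)"
proof -
  have "binary_rec (\<lambda>n z. rec_nat 0 (\<lambda>y r. r + z) n)"
    by (intro binary_rec_prim_rec unary_rec_const recursive_fn_3_last binary_rec_add)
  moreover have "rec_nat 0 (\<lambda>y r. r + z) n = n * z" for n z :: nat by (induction n) auto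
  ultimately show ?thesis by simp
qed

lemma unary_rec_triangle: "unary_rec triangle"
proof -
  have "binary_rec (\<lambda>n z. rec_nat 0 (\<lambda>y r. r + Suc y) n)"
    by (intro binary_rec_prim_rec unary_rec_const recursive_fn_comp2[OF binary_rec_add]
       recursive_fn_comp1[OF unary_rec_Suc] recursive_fn.proj) simp_all
  then have "unary_rec (\<lambda>n. rec_nat 0 (\<lambda>y r. r + Suc y) n)"
    by (rule unary_rec_comp2[OF _ unary_rec_id unary_rec_id])
  moreover have "(\<lambda>n. rec_nat 0 (\<lambda>y r. r + Suc y) n) = triangle"
  proof
    show "rec_nat 0 (\<lambda>y r. r + Suc y) n = triangle n" for n by (induction n) auto
  qed
  ultimately show ?thesis by (simp only:)
qed

lemma binary_rec_pair: "binary_rec (\<lambda>x y. prod_encode (x, y))"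
  unfolding prod_encode_def prod.case
  by (intro binary_rec_comp2[OF binary_rec_add] binary_rec_comp1[OF unary_rec_triangle]
      binary_rec_add binary_rec_fst)

lemma triangle_mono: "m \<le> n \<Longrightarrow> triangle m \<le> triangle n"
  by (induction rule: dec_induct) auto

text \<open>
  The Cantor pairing puts \<open>(a, b)\<close> at position \<open>a\<close> of the diagonal that starts at the triangular
  number of \<open>a + b\<close>. The diagonal is therefore found by minimization, and the components
  follow by subtraction.
\<close>

lemma Least_triangle: "(LEAST s. Suc (prod_encode (a, b)) - triangle (Suc s) = 0) = a + b"
proof (rule Least_equality)
  show "Suc (prod_encode (a, b)) - triangle (Suc (a + b)) = 0"
    by (simp add: prod_encode_def)
next
  fix s assume *: "Suc (prod_encode (a, b)) - triangle (Suc s) = 0"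
  show "a + b \<le> s"
  proof (rule ccontr)
    assume "\<not> a + b \<le> s"
    then have "triangle (Suc s) \<le> triangle (a + b)"
      by (intro triangle_mono) simp
    moreover have "Suc (triangle (a + b) + a) \<le> triangle (Suc s)"
      using * by (simp add: prod_encode_def del: triangle_Suc)
    ultimately show False by linarith
  qed
qed

lemma unary_rec_decode_sum: "unary_rec (\<lambda>z. fst (prod_decode z) + snd (prod_decode z))"
proof -
  let ?f = "\<lambda>s z. Suc z - triangle (Suc s)"
  have least: "(LEAST s. ?f s z = 0) = fst (prod_decode z) + snd (prod_decode z)" for z
    using Least_triangle[of "fst (prod_decode z)" "snd (prod_decode z)"] by simp
  have ex: "\<exists>s. ?f s z = 0" for z
  proof -
    have "triangle (Suc z) \<ge> Suc z" by (induction z) auto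
    then show ?thesis by (intro exI[of _ z]) simp
  qed
  have "binary_rec ?f"
    by (intro binary_rec_comp2[OF binary_rec_diff] binary_rec_comp1[OF unary_rec_triangle]
        binary_rec_comp1[OF unary_rec_Suc] binary_rec_fst binary_rec_snd)
  then have "recursive_fn (Suc 1) (\<lambda>xs. ?f (xs ! 0) (xs ! 1))"
    by (simp add: binary_rec_def numeral_2_eq_2)
  from recursive_fn.minim[OF this] ex
  have "recursive_fn 1 (\<lambda>xs. LEAST s. ?f s (xs ! 0) = 0)" by simp
  then show ?thesis by (simp only: least unary_rec_def)
qed

lemma unary_rec_fst: "unary_rec (\<lambda>z. fst (prod_decode z))"
proof -
  have "z - triangle (fst (prod_decode z) + snd (prod_decode z)) = fst (prod_decode z)" for z
  proof -
    have "z = triangle (fst (prod_decode z) + snd (prod_decode z)) + fst (prod_decode z)"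
      using prod_decode_inverse[of z] unfolding prod_encode_def by (simp add: case_prod_unfold)
    then show ?thesis by linarith
  qed
  moreover have "unary_rec (\<lambda>z. z - triangle (fst (prod_decode z) + snd (prod_decode z)))"
    by (intro unary_rec_comp2[OF binary_rec_diff] unary_rec_comp1[OF unary_rec_triangle]
        unary_rec_id unary_rec_decode_sum)
  ultimately show ?thesis by simp
qed

lemma unary_rec_snd: "unary_rec (\<lambda>z. snd (prod_decode z))"
proof -
  have "unary_rec (\<lambda>z. fst (prod_decode z) + snd (prod_decode z) - fst (prod_decode z))"
    by (intro unary_rec_comp2[OF binary_rec_diff] unary_rec_fst unary_rec_decode_sum)
  then show ?thesis by simp
qed

text \<open>
  With truncated subtraction, \<open>1 - c\<close> is the indicator of \<open>c = 0\<close>.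
\<close>

lemma unary_rec_if_zero:
  assumes "unary_rec c" "unary_rec f" "unary_rec g"
  shows "unary_rec (\<lambda>x. if c x = 0 then f x else g x)"
proof -
  \<comment> \<open>both branches are evaluated, which is harmless because all functions are total\<close>
  have "unary_rec (\<lambda>x. (1 - c x) * f x + (1 - (1 - c x)) * g x)"
    by (intro unary_rec_comp2[OF binary_rec_add] unary_rec_comp2[OF binary_rec_mult]
        unary_rec_comp2[OF binary_rec_diff] unary_rec_const assms)
  moreover have "(1 - c) * a + (1 - (1 - c)) * b = (if c = 0 then a else b)" for a b c :: nat
    by simp
  ultimately show ?thesis by (simp only:)
qed

section \<open>Computable functions between coded types\<close>

class codable =
  fixes code :: "'a \<Rightarrow> nat"
  assumes code_inject: "code x = code y \<Longrightarrow> x = y"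

lemma code_eq_iff: "code x = code y \<longleftrightarrow> x = y"
  using code_inject by blast

instantiation nat :: codable
begin
definition code_nat :: "nat \<Rightarrow> nat" where "code_nat n = n"
instance by standard (simp add: code_nat_def)
end

instantiation bool :: codable
begin
definition code_bool :: "bool \<Rightarrow> nat" where "code_bool b = of_bool b"
instance by standard (auto simp: code_bool_def of_bool_def split: if_splits)
end

instantiation prod :: (codable, codable) codable
begin
definition code_prod :: "'a \<times> 'b \<Rightarrow> nat" where
  "code_prod p = prod_encode (code (fst p), code (snd p))"
instance by standard (auto simp: code_prod_def code_eq_iff prod_eq_iff)
end

instantiation list :: (codable) codable
begin
definition code_list :: "'a list \<Rightarrow> nat" where "code_list xs = list_encode (map code xs)"
instance
proof
  fix xs ys :: "'a list" assume "code xs = code ys"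
  moreover have "inj (code :: 'a \<Rightarrow> nat)" by (rule injI) (rule code_inject)
  ultimately show "xs = ys" by (simp add: code_list_def list_encode_eq inj_map_eq_map)
qed
end

text \<open>
  An integer is coded by its positive and negative part, so that addition reduces to natural
  number arithmetic without a case distinction on signs.
\<close>

instantiation int :: codable
begin
definition code_int :: "int \<Rightarrow> nat" where "code_int i = code (nat i, nat (- i))"
instance by standard (auto simp: code_int_def code_eq_iff)
end

text \<open>
  An arbitrary but fixed enumeration of the coordinates, possibly with repetitions, through which
  vectors are coded as lists.
\<close>

definition index_list :: "'i::finite list" where
  "index_list = (SOME l. set l = UNIV)"

lemma set_index_list: "set (index_list :: 'i::finite list) = UNIV"
  unfolding index_list_def by (rule someI_ex) (simp add: finite_list)

lemma nth_index_list: "\<exists>j < length (index_list :: 'i list). index_list ! j = (i :: 'i::finite)"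
proof -
  have "i \<in> set index_list" by (simp add: set_index_list)
  then show ?thesis by (auto simp: in_set_conv_nth)
qed

instantiation vec :: (codable, finite) codable
begin
definition code_vec :: "('a, 'b) vec \<Rightarrow> nat" where
  "code_vec v = code (map (($) v) index_list)"
instance
  by standard (auto simp: code_vec_def code_eq_iff set_index_list vec_eq_iff)
end

text \<open>
  The realizer \<open>g\<close> is a total function, but its values on numbers that are not codes are
  irrelevant. The closure rules below are collected so that the computability of an expression
  follows by backward chaining along its syntax; functions bound inside an expression receive the
  surrounding variable and their own arguments as a nested pair.
\<close>

definition computable :: "('a::codable \<Rightarrow> 'b::codable) \<Rightarrow> bool" where
  "computable f \<longleftrightarrow> (\<exists>g. unary_rec g \<and> (\<forall>x. g (code x) = code (f x)))"

named_theorems computable_intros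

lemma computableI:
  "unary_rec g \<Longrightarrow> (\<And>x. g (code x) = code (f x)) \<Longrightarrow> computable f"
  by (auto simp: computable_def)

lemma computableE:
  assumes "computable f"
  obtains g where "unary_rec g" "\<And>x. g (code x) = code (f x)"
  using assms by (auto simp: computable_def)

lemma computable_nat_iff: "computable (f :: nat \<Rightarrow> nat) \<longleftrightarrow> unary_rec f"
proof
  assume "computable f"
  then obtain g where "unary_rec g" "\<And>x. g x = f x"
    by (auto elim: computableE simp: code_nat_def)
  moreover from this have "g = f" by auto
  ultimately show "unary_rec f" by simp
qed (auto intro: computableI simp: code_nat_def)

lemma computable_id [computable_intros]: "computable (\<lambda>x. x)"
  by (rule computableI[OF unary_rec_id]) simp

lemma computable_const [computable_intros]: "computable (\<lambda>x. c)"
  by (rule computableI[OF unary_rec_const]) simp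

lemma computable_same_code:
  assumes "computable f" "\<And>x. code (g x) = code (f x)"
  shows "computable g"
  using assms by (auto simp: computable_def)

lemma computable_comp:
  assumes "computable F" "computable f"
  shows "computable (\<lambda>x. F (f x))"
proof -
  obtain G g where *: "unary_rec G" "\<And>x. G (code x) = code (F x)"
    "unary_rec g" "\<And>x. g (code x) = code (f x)"
    using assms by (metis computableE)
  show ?thesis by (rule computableI[OF unary_rec_comp1[OF *(1,3)]]) (simp add: *)
qed

lemma computable_binary:
  assumes "binary_rec G" "\<And>a b. G (code a) (code b) = code (F a b)"
    and "computable f" "computable g"
  shows "computable (\<lambda>x. F (f x) (g x))"
proof -
  obtain f' g' where *: "unary_rec f'" "\<And>x. f' (code x) = code (f x)"
    "unary_rec g'" "\<And>x. g' (code x) = code (g x)"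
    using assms by (metis computableE)
  show ?thesis
    by (rule computableI[OF unary_rec_comp2[OF assms(1) *(1,3)]]) (simp add: * assms(2))
qed

lemma computable_Pair [computable_intros]:
  "computable f \<Longrightarrow> computable g \<Longrightarrow> computable (\<lambda>x. (f x, g x))"
  by (rule computable_binary[OF binary_rec_pair]) (simp_all add: code_prod_def)

lemma computable_fst [computable_intros]: "computable f \<Longrightarrow> computable (\<lambda>x. fst (f x))"
  by (rule computable_comp[OF computableI[OF unary_rec_fst]]) (simp_all add: code_prod_def)

lemma computable_snd [computable_intros]: "computable f \<Longrightarrow> computable (\<lambda>x. snd (f x))"
  by (rule computable_comp[OF computableI[OF unary_rec_snd]]) (simp_all add: code_prod_def)

lemma computable_if [computable_intros]:
  assumes "computable b" "computable f" "computable g"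
  shows "computable (\<lambda>x. if b x then f x else g x)"
proof -
  obtain b' where b': "unary_rec b'" "\<And>x. b' (code x) = code (b x)"
    using assms(1) unfolding computable_def by blast
  obtain f' where f': "unary_rec f'" "\<And>x. f' (code x) = code (f x)"
    using assms(2) unfolding computable_def by blast
  obtain g' where g': "unary_rec g'" "\<And>x. g' (code x) = code (g x)"
    using assms(3) unfolding computable_def by blast
  note * = b' f' g'
  show ?thesis
    by (rule computableI[OF unary_rec_if_zero[OF *(1,5,3)]])
      (simp add: * code_bool_def)
qed

lemma computable_conj [computable_intros]:
  assumes "computable b" "computable c"
  shows "computable (\<lambda>x. b x \<and> c x)"
proof -
  have "(\<lambda>x. b x \<and> c x) = (\<lambda>x. if b x then c x else False)" by auto
  then show ?thesis using assms by (simp only:) (intro computable_intros)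
qed

lemma computable_eq [computable_intros]:
  assumes "computable f" "computable g"
  shows "computable (\<lambda>x. f x = g x)"
proof -
  have "binary_rec (\<lambda>a b. 1 - ((a - b) + (b - a)))"
    by (intro binary_rec_comp2[OF binary_rec_add] binary_rec_comp2[OF binary_rec_diff]
        binary_rec_const binary_rec_fst binary_rec_snd)
  moreover have "1 - ((code a - code b) + (code b - code a)) = code (a = b)" for a b :: 'b
    using code_inject[of a b] by (cases "code a" "code b" rule: linorder_cases)
      (auto simp: code_bool_def)
  ultimately show ?thesis using computable_binary[of _ "(=)", OF _ _ assms] by blast
qed

lemma computable_add [computable_intros]:
  fixes f g :: "'a::codable \<Rightarrow> nat"
  shows "computable f \<Longrightarrow> computable g \<Longrightarrow> computable (\<lambda>x. f x + g x)"
  by (rule computable_binary[OF binary_rec_add]) (simp_all add: code_nat_def)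

lemma computable_diff [computable_intros]:
  fixes f g :: "'a::codable \<Rightarrow> nat"
  shows "computable f \<Longrightarrow> computable g \<Longrightarrow> computable (\<lambda>x. f x - g x)"
  by (rule computable_binary[OF binary_rec_diff]) (simp_all add: code_nat_def)

lemma computable_le [computable_intros]:
  fixes f g :: "'a::codable \<Rightarrow> nat"
  assumes "computable f" "computable g"
  shows "computable (\<lambda>x. f x \<le> g x)"
proof -
  have "computable (\<lambda>x. f x - g x = 0)" by (intro computable_intros assms)
  then show ?thesis by simp
qed

lemma computable_less [computable_intros]:
  fixes f g :: "'a::codable \<Rightarrow> nat"
  assumes "computable f" "computable g"
  shows "computable (\<lambda>x. f x < g x)"
proof -
  have "computable (\<lambda>x. f x + 1 \<le> g x)" by (intro computable_intros assms)
  then show ?thesis by (simp add: Suc_le_eq)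
qed

lemma computable_code [computable_intros]: "computable f \<Longrightarrow> computable (\<lambda>x. code (f x))"
  by (rule computable_same_code) (simp_all add: code_nat_def)

subsection \<open>Recursion over numbers and lists\<close>

lemma computable_rec_nat [computable_intros]:
  assumes "computable n" "computable a"
    and "computable (\<lambda>p. h (fst p) (fst (snd p)) (snd (snd p)))"
  shows "computable (\<lambda>x. rec_nat (a x) (h x) (n x))"
proof -
  obtain n' where n': "unary_rec n'" "\<And>x. n' (code x) = code (n x)"
    using assms(1) unfolding computable_def by blast
  obtain a' where a': "unary_rec a'" "\<And>x. a' (code x) = code (a x)"
    using assms(2) unfolding computable_def by blast
  obtain h' where h': "unary_rec h'" "\<And>p. h' (code p) = code (h (fst p) (fst (snd p)) (snd (snd p)))"
    using assms(3) unfolding computable_def by blast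
  note * = n' a' h'
  have "binary_rec (\<lambda>m z. rec_nat (a' z) (\<lambda>y r. h' (prod_encode (z, prod_encode (y, r)))) m)"
    by (intro binary_rec_prim_rec * recursive_fn_comp1[OF *(5)]
        recursive_fn_comp2[OF binary_rec_pair] recursive_fn.proj) simp_all
  moreover have "rec_nat (a' (code x)) (\<lambda>y r. h' (prod_encode (code x, prod_encode (y, r)))) m =
      code (rec_nat (a x) (h x) m)" for x m
  proof (induction m)
    case (Suc m)
    have "prod_encode (code x, prod_encode (m, code r)) = code (x, m, r)" for r :: 'b
      by (simp add: code_prod_def code_nat_def)
    then show ?case using Suc by (simp add: *)
  qed (simp add: *)
  ultimately show ?thesis
    by (intro computableI[OF unary_rec_comp2[OF _ *(1) unary_rec_id]]) (auto simp: * code_nat_def)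
qed

lemma code_Nil: "code [] = 0"
  by (simp add: code_list_def)

lemma code_Cons: "code (y # ys) = Suc (code (y, ys))"
  by (simp add: code_list_def code_prod_def)

lemma computable_Cons [computable_intros]:
  "computable f \<Longrightarrow> computable g \<Longrightarrow> computable (\<lambda>x. f x # g x)"
  by (rule computable_binary[OF binary_rec_comp1[OF unary_rec_Suc binary_rec_pair]])
    (simp_all add: code_Cons code_prod_def)

text \<open>
  The code of a nonempty list is the successor of the code of the pair of its head and its tail.
  A predecessor thus takes the list apart.
\<close>

lemma computable_case_list [computable_intros]:
  assumes "computable l" "computable a"
    and "computable (\<lambda>p. h (fst p) (fst (snd p)) (snd (snd p)))"
  shows "computable (\<lambda>x. case l x of [] \<Rightarrow> a x | y # ys \<Rightarrow> h x y ys)"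
proof -
  obtain l' where l': "unary_rec l'" "\<And>x. l' (code x) = code (l x)"
    using assms(1) unfolding computable_def by blast
  obtain a' where a': "unary_rec a'" "\<And>x. a' (code x) = code (a x)"
    using assms(2) unfolding computable_def by blast
  obtain h' where h': "unary_rec h'" "\<And>p. h' (code p) = code (h (fst p) (fst (snd p)) (snd (snd p)))"
    using assms(3) unfolding computable_def by blast
  note * = l' a' h'
  \<comment> \<open>on the code of a nonempty list, the predecessor is the code of the pair of head and tail\<close>
  have "unary_rec (\<lambda>x. h' (prod_encode (x, l' x - 1)))"
    by (intro unary_rec_comp1[OF *(5)] unary_rec_comp2[OF binary_rec_pair] unary_rec_id
        unary_rec_comp2[OF binary_rec_diff] * unary_rec_const)
  from unary_rec_if_zero[OF *(1,3) this] show ?thesis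
  proof (rule computableI)
    fix x
    show "(if l' (code x) = 0 then a' (code x) else h' (prod_encode (code x, l' (code x) - 1))) =
        code (case l x of [] \<Rightarrow> a x | y # ys \<Rightarrow> h x y ys)"
    proof (cases "l x")
      case (Cons y ys)
      have "prod_encode (code x, code (y, ys)) = code (x, y, ys)" by (simp add: code_prod_def)
      then show ?thesis by (simp add: * Cons code_Cons)
    qed (simp add: * code_Nil)
  qed
qed

text \<open>
  This bounds the number of steps of a loop over a list by a number that is at hand.
\<close>

lemma length_le_code: "length xs \<le> code xs"
proof (induction xs)
  case (Cons x xs)
  have "code xs \<le> code (x, xs)" by (simp add: code_prod_def le_prod_encode_2)
  with Cons show ?case by (simp add: code_Cons)
qed simp

lemma computable_foldl [computable_intros]:
  assumes "computable l" "computable a"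
    and "computable (\<lambda>p. h (fst p) (fst (snd p)) (snd (snd p)))"
  shows "computable (\<lambda>x. foldl (h x) (a x) (l x))"
proof -
  \<comment> \<open>one turn of the loop on the pair of accumulator and remaining list; on an exhausted list it idles\<close>
  define step where "step = (\<lambda>x p.
    case snd p of [] \<Rightarrow> (fst p, []) | y # ys \<Rightarrow> (h x (fst p) y, ys))"
  have rec: "rec_nat (r, ys) (\<lambda>_. step x) m = (foldl (h x) r (take m ys), drop m ys)" for x r ys m
  proof (induction m)
    case (Suc m)
    show ?case
    proof (cases "drop m ys")
      case (Cons z zs)
      then have "m < length ys" by (metis drop_all list.discI not_le)
      then show ?thesis using Cons Suc
        by (simp add: step_def take_Suc_conv_app_nth drop_Suc tl_drop)
          (metis Cons_nth_drop_Suc list.inject drop_Suc tl_drop)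
    qed (use Suc in \<open>simp add: step_def drop_Suc tl_drop\<close>)
  qed simp
  have "computable (\<lambda>p. step (fst p) (snd (snd p)))"
    unfolding step_def
    by (intro computable_intros computable_comp[OF assms(3), where
       f = "\<lambda>p. (fst (fst p), fst (snd (snd (fst p))), fst (snd p))", simplified])
  then have "computable (\<lambda>x. fst (rec_nat (a x, l x) (\<lambda>_. step x) (code (l x))))"
    by (intro computable_intros assms)
  then show ?thesis by (simp add: rec length_le_code)
qed

lemma computable_rev [computable_intros]:
  assumes "computable l" shows "computable (\<lambda>x. rev (l x))"
proof -
  have "computable (\<lambda>x. foldl (\<lambda>acc y. y # acc) [] (l x))" by (intro computable_intros assms)
  moreover have "foldl (\<lambda>acc y. y # acc) acc ys = rev ys @ acc" for acc ys :: "'b list"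
    by (induction ys arbitrary: acc) auto
  ultimately show ?thesis by simp
qed

lemma computable_foldr [computable_intros]:
  assumes "computable l" "computable a"
    and "computable (\<lambda>p. h (fst p) (fst (snd p)) (snd (snd p)))"
  shows "computable (\<lambda>x. foldr (h x) (l x) (a x))"
  unfolding foldr_conv_foldl
  by (intro computable_intros assms computable_comp[OF assms(3), where
       f = "\<lambda>p. (fst p, snd (snd p), fst (snd p))", simplified])

lemma computable_map [computable_intros]:
  assumes "computable l" "computable (\<lambda>p. h (fst p) (snd p))"
  shows "computable (\<lambda>x. map (h x) (l x))"
proof -
  have "computable (\<lambda>x. foldr (\<lambda>y acc. h x y # acc) (l x) [])"
    by (intro computable_intros assms computable_comp[OF assms(2), where
       f = "\<lambda>p. (fst p, fst (snd p))", simplified])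
  moreover have "foldr (\<lambda>y acc. h x y # acc) ys [] = map (h x) ys" for x ys
    by (induction ys) auto
  ultimately show ?thesis by simp
qed

lemma computable_append [computable_intros]:
  assumes "computable f" "computable g" shows "computable (\<lambda>x. f x @ g x)"
proof -
  have "computable (\<lambda>x. foldr (\<lambda>y ys. y # ys) (f x) (g x))" by (intro computable_intros assms)
  moreover have "foldr (\<lambda>y ys. y # ys) xs ys = xs @ ys" for xs ys :: "'b list"
    by (induction xs) auto
  ultimately show ?thesis by simp
qed

lemma computable_concat [computable_intros]:
  assumes "computable f" shows "computable (\<lambda>x. concat (f x))"
proof -
  have "computable (\<lambda>x. foldr (\<lambda>y ys. y @ ys) (f x) [])" by (intro computable_intros assms)
  moreover have "foldr (\<lambda>y ys. y @ ys) xs [] = concat xs" for xs :: "'b list list"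
    by (induction xs) auto
  ultimately show ?thesis by simp
qed

lemma computable_list_all [computable_intros]:
  assumes "computable l" "computable (\<lambda>p. h (fst p) (snd p))"
  shows "computable (\<lambda>x. list_all (h x) (l x))"
proof -
  have "computable (\<lambda>x. foldr (\<lambda>y acc. h x y \<and> acc) (l x) True)"
    by (intro computable_intros assms computable_comp[OF assms(2), where
       f = "\<lambda>p. (fst p, fst (snd p))", simplified])
  moreover have "foldr (\<lambda>y acc. h x y \<and> acc) ys True = list_all (h x) ys" for x ys
    by (induction ys) auto
  ultimately show ?thesis by simp
qed

text \<open>
  Here \<open>j\<close> is a fixed number, so that finitely many list destructors suffice.
\<close>

lemma computable_nth_default [computable_intros]:
  "computable f \<Longrightarrow> computable (\<lambda>x. nth_default d (f x) j)"
proof (induction j arbitrary: f)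
  case 0
  have "computable (\<lambda>x. case f x of [] \<Rightarrow> d | y # ys \<Rightarrow> y)" by (intro computable_intros 0)
  moreover have "nth_default d ys 0 = (case ys of [] \<Rightarrow> d | y # ys \<Rightarrow> y)" for ys
    by (cases ys) auto
  ultimately show ?case by simp
next
  case (Suc j)
  have "computable (\<lambda>x. case f x of [] \<Rightarrow> [] | y # ys \<Rightarrow> ys)" by (intro computable_intros Suc)
  from Suc.IH[OF this]
  have "computable (\<lambda>x. nth_default d (case f x of [] \<Rightarrow> [] | y # ys \<Rightarrow> ys) j)" .
  moreover have "nth_default d (case ys of [] \<Rightarrow> [] | y # ys \<Rightarrow> ys) j = nth_default d ys (Suc j)"
    for ys by (cases ys) auto
  ultimately show ?case by simp
qed

subsection \<open>Integers and integer vectors\<close>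

lemma computable_int_diff [computable_intros]:
  assumes "computable f" "computable g"
  shows "computable (\<lambda>x. int (f x) - int (g x))"
proof (rule computable_same_code)
  show "computable (\<lambda>x. (f x - g x, g x - f x))" by (intro computable_intros assms)
qed (simp add: code_int_def nat_minus_as_int)

lemma computable_nat [computable_intros]:
  assumes "computable f" shows "computable (\<lambda>x. nat (f x))"
proof -
  have "computable (\<lambda>x. (nat (f x), nat (- f x)))"
    by (rule computable_same_code[OF assms]) (simp add: code_int_def)
  from computable_fst[OF this] show ?thesis by simp
qed

lemma computable_nat_minus:
  assumes "computable f" shows "computable (\<lambda>x. nat (- f x))"
proof -
  have "computable (\<lambda>x. (nat (f x), nat (- f x)))"
    by (rule computable_same_code[OF assms]) (simp add: code_int_def)
  from computable_snd[OF this] show ?thesis by simp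
qed

text \<open>
  The two parts of \<open>a + b\<close> are recovered from the difference of the sums of the positive and the
  negative parts.
\<close>

lemma computable_int_add:
  fixes f g :: "'a::codable \<Rightarrow> int"
  assumes "computable f" "computable g"
  shows "computable (\<lambda>x. f x + g x)"
proof -
  have "computable (\<lambda>x. int (nat (f x) + nat (g x)) - int (nat (- f x) + nat (- g x)))"
    by (intro computable_intros computable_nat_minus assms)
  moreover have "int (nat a + nat b) - int (nat (- a) + nat (- b)) = a + b" for a b by simp
  ultimately show ?thesis by simp
qed

lemma computable_vec_nth:
  fixes f :: "'a::codable \<Rightarrow> ('b::codable, 'i::finite) vec"
  assumes "computable f"
  shows "computable (\<lambda>x. f x $ i)"
proof -
  obtain j where j: "j < length (index_list :: 'i list)" "index_list ! j = i"
    using nth_index_list by blast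
  have "computable (\<lambda>x. map (($) (f x)) index_list)"
    by (rule computable_same_code[OF assms]) (simp add: code_vec_def)
  then have "computable (\<lambda>x. nth_default undefined (map (($) (f x)) index_list) j)"
    by (rule computable_nth_default)
  then show ?thesis using j by (simp add: nth_default_def)
qed

lemma computable_vec:
  fixes f :: "'a::codable \<Rightarrow> ('b::codable, 'i::finite) vec"
  assumes "\<And>i. computable (\<lambda>x. f x $ i)"
  shows "computable f"
proof (rule computable_same_code)
  have "computable (\<lambda>x. map (($) (f x)) is)" for "is"
    by (induction "is") (auto intro!: computable_intros assms)
  then show "computable (\<lambda>x. map (($) (f x)) index_list)" .
qed (simp add: code_vec_def)

lemma computable_vec_add [computable_intros]:
  fixes f g :: "'a::codable \<Rightarrow> int ^ 'i::finite"
  assumes "computable f" "computable g"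
  shows "computable (\<lambda>x. f x + g x)"
  by (rule computable_vec) (simp add: computable_int_add computable_vec_nth assms)

subsection \<open>Decoders\<close>

text \<open>
  A decoder retracts numbers onto a type. On a number that is not a code it returns some element,
  which turns every number into a name of an element.
\<close>

definition decoder :: "(nat \<Rightarrow> 'a::codable) \<Rightarrow> bool" where
  "decoder f \<longleftrightarrow> computable f \<and> (\<forall>x. f (code x) = x)"

lemma decoder_nat: "decoder (\<lambda>n. n)"
  by (simp add: decoder_def computable_id code_nat_def)

lemma decoder_bool: "decoder (\<lambda>n. n = 1)"
  by (auto simp: decoder_def code_bool_def intro!: computable_intros)

lemma computable_prod_decode: "computable prod_decode"
  by (rule computable_same_code[OF computable_id]) (simp add: code_prod_def code_nat_def)

lemma decoder_prod:
  assumes "decoder f" "decoder g"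
  shows "decoder (\<lambda>n. (f (fst (prod_decode n)), g (snd (prod_decode n))))"
  using assms computable_comp[of f] computable_comp[of g]
  by (auto simp: decoder_def code_prod_def intro!: computable_Pair computable_prod_decode
      computable_fst computable_snd)

lemma decoder_list:
  assumes "decoder f"
  shows "decoder (\<lambda>n. map f (list_decode n))"
proof -
  have "computable list_decode"
    by (rule computable_same_code[OF computable_id])
      (simp add: code_list_def code_nat_def[abs_def])
  moreover have "computable (\<lambda>p :: nat \<times> nat. f (snd p))"
    using assms by (intro computable_comp[OF _ computable_snd[OF computable_id]]) (simp add: decoder_def)
  ultimately have "computable (\<lambda>n. map f (list_decode n))" by (rule computable_map)
  then show ?thesis using assms by (simp add: decoder_def code_list_def map_idI)
qed

lemma decoder_int: "decoder (\<lambda>n. int (fst (prod_decode n)) - int (snd (prod_decode n)))"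
  by (auto simp: decoder_def code_int_def code_prod_def code_nat_def
      intro!: computable_intros computable_prod_decode)

lemma decoder_vec:
  fixes f :: "nat \<Rightarrow> 'a::codable"
  assumes "decoder f"
  shows "\<exists>g :: nat \<Rightarrow> ('a, 'i::finite) vec. decoder g"
proof -
  obtain pos where pos: "\<And>i :: 'i. pos i < length (index_list :: 'i list)"
    "\<And>i :: 'i. index_list ! pos i = i" using nth_index_list by metis
  define g :: "nat \<Rightarrow> ('a, 'i) vec" where
    "g = (\<lambda>n. \<chi> i. nth_default undefined (map f (list_decode n)) (pos i))"
  have "computable (\<lambda>n. map f (list_decode n))" and inv: "map f (list_decode (code xs)) = xs" for xs
    using decoder_list[OF assms] by (auto simp: decoder_def)
  then have "computable g"
    unfolding g_def by (intro computable_vec) (simp add: computable_nth_default)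
  moreover have "g (code v) = v" for v
  proof -
    have "g (code v) = (\<chi> i. nth_default undefined (map (($) v) index_list) (pos i))"
      by (simp only: g_def code_vec_def inv)
    then show ?thesis by (simp add: nth_default_def pos)
  qed
  ultimately show ?thesis unfolding decoder_def by blast
qed

text \<open>
  A number is a code exactly if decoding and coding again returns it, so the range of a coding
  function with a decoder is recursive.
\<close>

lemma recursive_set_image_code:
  fixes P :: "'a::codable \<Rightarrow> bool" and f :: "nat \<Rightarrow> 'a"
  assumes P: "computable P" and f: "decoder f"
  shows "recursive_set (code ` {x. P x})"
proof -
  have comp: "computable f" and inv: "f (code x) = x" for x
    using f by (auto simp: decoder_def)
  \<comment> \<open>the test \<open>code (f n) = n\<close> rejects numbers that code nothing\<close>
  have "computable (\<lambda>n. if code (f n) = n \<and> P (f n) then 1 else 0 :: nat)"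
    by (intro computable_intros computable_comp[OF P] comp)
  moreover have "(code (f n) = n \<and> P (f n)) \<longleftrightarrow> n \<in> code ` {x. P x}" for n
    using inv by (metis (mono_tags, lifting) imageE image_eqI mem_Collect_eq)
  ultimately show ?thesis by (simp add: computable_nat_iff unary_rec_def recursive_set_def)
qed

lemma re_set_recursive_set:
  assumes A: "recursive_set A"
  shows "re_set A"
proof (cases "A = {}")
  case False
  then obtain a where a: "a \<in> A" by blast
  let ?f = "\<lambda>i. if (if i \<in> A then 1 else 0 :: nat) = 0 then a else i"
  have "unary_rec ?f"
    using A by (intro unary_rec_if_zero unary_rec_const unary_rec_id)
      (simp add: recursive_set_def unary_rec_def)
  moreover have "A = range ?f" using a by (auto simp: image_iff)
  ultimately show ?thesis
    unfolding re_set_def unary_rec_def by (intro disjI2 exI[of _ "\<lambda>xs. ?f (xs ! 0)"]) simp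
qed (simp add: re_set_def)

section \<open>Programs\<close>

text \<open>
  A rule consists of a pattern to be read, the current state, a pattern to be written, the new
  state and the move; cells are given relative to the head. The same type of cell lists also
  represents finite tapes.
\<close>

type_synonym 'd cells = "((int ^ 'd) \<times> nat) list"
type_synonym 'd rule = "'d cells \<times> nat \<times> 'd cells \<times> nat \<times> (int ^ 'd)"
type_synonym 'd program = "'d rule list"

abbreviation reads :: "'d rule \<Rightarrow> 'd cells" where "reads r \<equiv> fst r"
abbreviation source :: "'d rule \<Rightarrow> nat" where "source r \<equiv> fst (snd r)"
abbreviation writes :: "'d rule \<Rightarrow> 'd cells" where "writes r \<equiv> fst (snd (snd r))"
abbreviation target :: "'d rule \<Rightarrow> nat" where "target r \<equiv> fst (snd (snd (snd r)))"
abbreviation move :: "'d rule \<Rightarrow> int ^ 'd" where "move r \<equiv> snd (snd (snd (snd r)))"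

abbreviation tape_of :: "'t \<times> nat \<times> 'v \<Rightarrow> 't" where "tape_of c \<equiv> fst c"
abbreviation state_of :: "'t \<times> nat \<times> 'v \<Rightarrow> nat" where "state_of c \<equiv> fst (snd c)"
abbreviation head_of :: "'t \<times> nat \<times> 'v \<Rightarrow> 'v" where "head_of c \<equiv> snd (snd c)"

text \<open>
  The first entry for a cell counts, so writing amounts to prepending. The value \<open>a\<close> is read from
  cells that are not listed: \<open>0\<close> for finite tapes, and the old symbol when a pattern is written.
\<close>

definition content :: "nat \<Rightarrow> ((int ^ 'd::finite) \<times> nat) list \<Rightarrow> int ^ 'd \<Rightarrow> nat" where
  "content a t z = foldr (\<lambda>p b. if fst p = z then snd p else b) t a"

definition matches :: "'d::finite rule \<Rightarrow> 'd config \<Rightarrow> bool" where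
  "matches r c \<longleftrightarrow> source r = state_of c \<and>
    list_all (\<lambda>p. tape_of c (head_of c + fst p) = snd p) (reads r)"

definition apply_rule :: "'d::finite rule \<Rightarrow> 'd config \<Rightarrow> 'd config" where
  "apply_rule r c =
    (\<lambda>z. content (tape_of c z) (writes r) (z - head_of c), target r, head_of c + move r)"

text \<open>
  The first matching rule is applied, and nothing happens if there is none. In particular the empty
  program is the identity.
\<close>

definition exec :: "'d::finite program \<Rightarrow> 'd config \<Rightarrow> 'd config" where
  "exec p c = foldr (\<lambda>r c'. if matches r c then apply_rule r c else c') p c"

text \<open>
  The last program of the list runs first, in agreement with the composition of maps.
\<close>

definition run :: "'d::finite program list \<Rightarrow> 'd config \<Rightarrow> 'd config" where
  "run ps c = foldr exec ps c"

text \<open>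
  Only what a rule writes has to be constrained: a rule that asks for an impossible symbol or
  state never matches.
\<close>

definition well_formed :: "nat \<Rightarrow> nat \<Rightarrow> 'd::finite program \<Rightarrow> bool" where
  "well_formed n k p \<longleftrightarrow>
    list_all (\<lambda>r. list_all (\<lambda>w. snd w < n) (writes r) \<and> 1 \<le> target r \<and> target r \<le> k) p"

lemma content_Nil [simp]: "content a [] z = a"
  by (simp add: content_def)

lemma content_Cons [simp]: "content a (p # t) z = (if fst p = z then snd p else content a t z)"
  by (simp add: content_def)

lemma content_append: "content a (s @ t) z = content (content a t z) s z"
  by (induction s) auto

lemma content_outside: "z \<notin> fst ` set t \<Longrightarrow> content a t z = a"
  by (induction t) auto

lemma content_less: "a < n \<Longrightarrow> \<forall>p \<in> set t. snd p < n \<Longrightarrow> content a t z < n"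
  by (induction t) auto

lemma content_map_graph: "content a (map (\<lambda>z. (z, x z)) C) z = (if z \<in> set C then x z else a)"
  by (induction C) auto

lemma content_shift: "content a (map (\<lambda>p. (v + fst p, snd p)) t) z = content a t (z - v)"
  by (induction t) (auto simp: algebra_simps)

lemma exec_Nil [simp]: "exec [] c = c"
  by (simp add: exec_def)

lemma exec_cases:
  obtains "exec p c = c" "\<And>r. r \<in> set p \<Longrightarrow> \<not> matches r c"
  | r where "r \<in> set p" "matches r c" "exec p c = apply_rule r c"
proof -
  have "(exec p c = c \<and> (\<forall>r \<in> set p. \<not> matches r c)) \<or>
      (\<exists>r \<in> set p. matches r c \<and> exec p c = apply_rule r c)"
  proof (induction p)
    case (Cons r p)
    then show ?case by (cases "matches r c") (auto simp: exec_def)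
  qed (simp add: exec_def)
  then show thesis using that by blast
qed

lemma run_Nil [simp]: "run [] c = c"
  by (simp add: run_def)

lemma run_Cons [simp]: "run (p # ps) c = exec p (run ps c)"
  by (simp add: run_def)

lemma run_append: "run (ps @ qs) c = run ps (run qs c)"
  by (simp add: run_def)

lemma mem_configs_iff:
  "c \<in> configs n k \<longleftrightarrow> (\<forall>z. tape_of c z < n) \<and> state_of c \<in> {1..k}"
  by (cases c) (auto simp: configs_def patterns_def PiE_def extensional_def)

lemma exec_configs:
  assumes "well_formed n k p" "c \<in> configs n k"
  shows "exec p c \<in> configs n k"
proof (cases rule: exec_cases[of p c])
  case (2 r)
  then show ?thesis using assms
    by (auto simp: apply_rule_def mem_configs_iff well_formed_def list_all_iff intro!: content_less)
qed (use assms in simp)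

lemma run_configs:
  assumes "list_all (well_formed n k) ps" "c \<in> configs n k"
  shows "run ps c \<in> configs n k"
  using assms by (induction ps) (auto intro: exec_configs)

subsection \<open>Translation invariance\<close>

definition translate :: "int ^ 'd::finite \<Rightarrow> 'd config \<Rightarrow> 'd config" where
  "translate w c = (shift w (tape_of c), state_of c, head_of c + w)"

lemma exec_translate: "exec p (translate w c) = translate w (exec p c)"
proof -
  have "matches r (translate w c) = matches r c" for r
    by (simp add: matches_def translate_def shift_def algebra_simps)
  moreover have "apply_rule r (translate w c) = translate w (apply_rule r c)" for r
    by (simp add: apply_rule_def translate_def shift_def algebra_simps)
  ultimately show ?thesis
    unfolding exec_def by (induction p) auto
qed

lemma run_translate: "run ps (translate w c) = translate w (run ps c)"
  by (induction ps) (auto simp: exec_translate)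

lemma translate_to_origin: "translate (head_of c) (shift (- head_of c) (tape_of c), state_of c, 0) = c"
  by (simp add: translate_def shift_def)

subsection \<open>Locality\<close>

text \<open>
  The zero offset records that the head may stay where it is. It makes the sets \<open>reach\<close> below
  increase with the list of programs.
\<close>

definition offsets :: "'d::finite program \<Rightarrow> (int ^ 'd) list" where
  "offsets p = 0 # concat (map (\<lambda>r. move r # map fst (reads r) @ map fst (writes r)) p)"

text \<open>
  Starting at the origin, neither the head nor any access to the tape leaves these cells. For
  simplicity every offset is treated as a possible move.
\<close>

definition reach :: "'d::finite program list \<Rightarrow> (int ^ 'd) list" where
  "reach ps = foldr (\<lambda>p R. concat (map (\<lambda>v. map (\<lambda>u. v + u) (offsets p)) R)) ps [0]"

definition agree :: "(int ^ 'd::finite) set \<Rightarrow> 'd config \<Rightarrow> 'd config \<Rightarrow> bool" where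
  "agree D c c' \<longleftrightarrow> snd c = snd c' \<and> (\<forall>z \<in> D. tape_of c z = tape_of c' z)"

lemma exec_local:
  assumes "agree D c c'" and D: "\<forall>u \<in> set (offsets p). head_of c + u \<in> D"
  shows "agree D (exec p c) (exec p c')"
proof -
  have m: "matches r c = matches r c'" if "r \<in> set p" for r
  proof -
    have "head_of c + fst w \<in> D" if "w \<in> set (reads r)" for w
      using D that \<open>r \<in> set p\<close> by (fastforce simp: offsets_def)
    then show ?thesis using assms(1) by (auto simp: matches_def list_all_iff agree_def)
  qed
  have "agree D (apply_rule r c) (apply_rule r c')" for r
    using assms(1) by (simp add: apply_rule_def agree_def)
  then have "agree D (foldr (\<lambda>r e. if matches r c then apply_rule r c else e) p' c)
      (foldr (\<lambda>r e. if matches r c' then apply_rule r c' else e) p' c')"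
    if "set p' \<subseteq> set p" for p'
    using that assms(1) m by (induction p') auto
  then show ?thesis by (simp add: exec_def)
qed

lemma exec_outside:
  assumes "\<forall>u \<in> set (offsets p). head_of c + u \<in> D" "z \<notin> D"
  shows "tape_of (exec p c) z = tape_of c z"
proof (cases rule: exec_cases[of p c])
  case (2 r)
  have "z - head_of c \<notin> fst ` set (writes r)"
  proof
    assume "z - head_of c \<in> fst ` set (writes r)"
    then have "z - head_of c \<in> set (offsets p)" using 2 by (auto simp: offsets_def)
    with assms show False by (metis add_diff_cancel_left' diff_add_cancel add.commute)
  qed
  then show ?thesis using 2 by (simp add: apply_rule_def content_outside)
qed simp

lemma exec_head: "\<exists>u \<in> set (offsets p). head_of (exec p c) = head_of c + u"
proof (cases rule: exec_cases[of p c])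
  case (2 r)
  then show ?thesis by (auto simp: apply_rule_def offsets_def)
qed (auto simp: offsets_def)

lemma mem_reach_Cons:
  "z \<in> set (reach (p # ps)) \<longleftrightarrow> (\<exists>v \<in> set (reach ps). \<exists>u \<in> set (offsets p). z = v + u)"
  by (auto simp: reach_def)

lemma reach_Cons_mono: "set (reach ps) \<subseteq> set (reach (p # ps))"
proof
  fix v assume "v \<in> set (reach ps)"
  moreover have "v = v + 0" "0 \<in> set (offsets p)" by (auto simp: offsets_def)
  ultimately show "v \<in> set (reach (p # ps))" unfolding mem_reach_Cons by blast
qed

text \<open>
  Inside \<open>D\<close> the computation does not depend on the tape outside, and it leaves the tape outside
  unchanged. Taken together, the action on all configurations with head at the origin is determined
  by what happens on \<open>D\<close>.
\<close>

lemma run_local: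
  assumes "agree D c c'" "head_of c = 0" "set (reach ps) \<subseteq> D"
  shows "agree D (run ps c) (run ps c') \<and> head_of (run ps c) \<in> set (reach ps) \<and>
    (\<forall>z. z \<notin> D \<longrightarrow> tape_of (run ps c) z = tape_of c z)"
  using assms(3)
proof (induction ps)
  case Nil
  then show ?case using assms by (simp add: reach_def)
next
  case (Cons p ps)
  then have IH: "agree D (run ps c) (run ps c')" "head_of (run ps c) \<in> set (reach ps)"
    "\<And>z. z \<notin> D \<Longrightarrow> tape_of (run ps c) z = tape_of c z"
    using reach_Cons_mono[of ps p] by auto
  have D: "\<forall>u \<in> set (offsets p). head_of (run ps c) + u \<in> D"
    using Cons.prems IH(2) mem_reach_Cons[of _ p ps] by blast
  have "head_of (run (p # ps) c) \<in> set (reach (p # ps))"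
    using exec_head[of p "run ps c"] IH(2) unfolding mem_reach_Cons run_Cons by blast
  then show ?case
    using exec_local[OF IH(1) D] exec_outside[OF D] IH(3) by simp
qed

section \<open>Deciding whether a product of programs is the identity\<close>

text \<open>
  A finite tape stands for the full tape that is zero on all unlisted cells. These
  configurations are closed under the action of programs, so the simulation on finite tapes is
  exact.
\<close>

definition denote :: "'d::finite cells \<times> nat \<times> (int ^ 'd) \<Rightarrow> 'd config" where
  "denote c = (content 0 (tape_of c), snd c)"

definition sim_matches :: "'d::finite rule \<Rightarrow> 'd cells \<times> nat \<times> (int ^ 'd) \<Rightarrow> bool" where
  "sim_matches r c \<longleftrightarrow> source r = state_of c \<and>
    list_all (\<lambda>p. content 0 (tape_of c) (head_of c + fst p) = snd p) (reads r)"

definition sim_apply ::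
  "'d::finite rule \<Rightarrow> 'd cells \<times> nat \<times> (int ^ 'd) \<Rightarrow> 'd cells \<times> nat \<times> (int ^ 'd)" where
  "sim_apply r c = (map (\<lambda>p. (head_of c + fst p, snd p)) (writes r) @ tape_of c,
    target r, head_of c + move r)"

definition sim_exec ::
  "'d::finite program \<Rightarrow> 'd cells \<times> nat \<times> (int ^ 'd) \<Rightarrow> 'd cells \<times> nat \<times> (int ^ 'd)" where
  "sim_exec p c = foldr (\<lambda>r c'. if sim_matches r c then sim_apply r c else c') p c"

definition sim_run ::
  "'d::finite program list \<Rightarrow> 'd cells \<times> nat \<times> (int ^ 'd) \<Rightarrow> 'd cells \<times> nat \<times> (int ^ 'd)" where
  "sim_run ps c = foldr sim_exec ps c"

lemma denote_sim_exec: "denote (sim_exec p c) = exec p (denote c)"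
proof -
  have "sim_matches r c = matches r (denote c)" for r
    by (simp add: sim_matches_def matches_def denote_def)
  moreover have "denote (sim_apply r c) = apply_rule r (denote c)" for r
    by (auto simp: sim_apply_def apply_rule_def denote_def content_append content_shift)
  ultimately show ?thesis
    unfolding sim_exec_def exec_def by (induction p) auto
qed

lemma denote_sim_run: "denote (sim_run ps c) = run ps (denote c)"
  unfolding sim_run_def run_def by (induction ps) (auto simp: denote_sim_exec)

definition all_tapes :: "nat \<Rightarrow> (int ^ 'd::finite) list \<Rightarrow> 'd cells list" where
  "all_tapes n C =
    foldr (\<lambda>z ts. concat (map (\<lambda>t. map (\<lambda>a. (z, a) # t) [0..<n]) ts)) C [[]]"

lemma graph_mem_all_tapes:
  "\<forall>z. x z < n \<Longrightarrow> map (\<lambda>z. (z, x z)) C \<in> set (all_tapes n C)"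
  by (induction C) (force simp: all_tapes_def)+

lemma all_tapes_less: "t \<in> set (all_tapes n C) \<Longrightarrow> \<forall>p \<in> set t. snd p < n"
  by (induction C arbitrary: t) (fastforce simp: all_tapes_def)+

definition returns :: "'d::finite program list \<Rightarrow> 'd cells \<times> nat \<times> (int ^ 'd) \<Rightarrow> bool" where
  "returns ps c \<longleftrightarrow> snd (sim_run ps c) = snd c \<and>
    list_all (\<lambda>p. content 0 (tape_of (sim_run ps c)) (fst p) = content 0 (tape_of c) (fst p))
      (tape_of (sim_run ps c) @ tape_of c)"

text \<open>
  Both tapes vanish on all unlisted cells, so only finitely many cells have to be compared.
\<close>

lemma content_eq_iff:
  "content 0 s = content 0 t \<longleftrightarrow>
    list_all (\<lambda>p. content 0 s (fst p) = content 0 t (fst p)) (s @ t)" (is "?L \<longleftrightarrow> ?R")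
proof
  assume ?R
  show ?L
  proof
    fix z
    show "content 0 s z = content 0 t z"
    proof (cases "z \<in> fst ` set (s @ t)")
      case True
      then show ?thesis using \<open>?R\<close> by (auto simp: list_all_iff)
    next
      case False
      then show ?thesis by (simp add: image_Un content_outside)
    qed
  qed
qed (simp add: list_all_iff)

lemma returns_iff: "returns ps c \<longleftrightarrow> run ps (denote c) = denote c"
proof -
  have "run ps (denote c) = denote c \<longleftrightarrow>
      snd (sim_run ps c) = snd c \<and> content 0 (tape_of (sim_run ps c)) = content 0 (tape_of c)"
    unfolding denote_sim_run[symmetric] by (auto simp: denote_def)
  then show ?thesis by (simp only: returns_def content_eq_iff)
qed

definition acts_trivially :: "nat \<Rightarrow> nat \<Rightarrow> 'd::finite program list \<Rightarrow> bool" where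
  "acts_trivially n k ps \<longleftrightarrow>
    list_all (\<lambda>t. list_all (\<lambda>q. returns ps (t, q, 0)) [1..<Suc k]) (all_tapes n (reach ps))"

text \<open>
  An arbitrary configuration is moved to the origin by a translation, and its tape is then
  replaced by zero outside the reach; by locality the product fixes the original configuration if
  it fixes the modified one. The assumption on \<open>n\<close> makes \<open>0\<close> a legal symbol.
\<close>

lemma acts_trivially_iff:
  fixes ps :: "'d::finite program list"
  assumes "n \<ge> 1"
  shows "acts_trivially n k ps \<longleftrightarrow> (\<forall>c \<in> configs n k. run ps c = c)"
proof
  assume *: "\<forall>c \<in> configs n k. run ps c = c"
  have "denote (t, q, 0) \<in> configs n k" if "t \<in> set (all_tapes n (reach ps))" "q \<in> {1..k}" for t q
    using that assms all_tapes_less[OF that(1)]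
    by (auto simp: mem_configs_iff denote_def intro!: content_less)
  then show "acts_trivially n k ps"
    using * by (auto simp: acts_trivially_def returns_iff list_all_iff)
next
  assume *: "acts_trivially n k ps"
  show "\<forall>c \<in> configs n k. run ps c = c"
  proof
    fix c :: "'d config" assume c: "c \<in> configs n k"
    let ?D = "set (reach ps)"
    \<comment> \<open>the translate of \<open>c\<close> with its head at the origin\<close>
    define c0 where "c0 = (shift (- head_of c) (tape_of c), state_of c, 0 :: int ^ 'd)"
    have "\<forall>z. tape_of c0 z < n" "state_of c0 \<in> {1..k}"
      using c by (auto simp: c0_def mem_configs_iff shift_def)
    \<comment> \<open>the tape of \<open>c0\<close> cut off outside the reach\<close>
    define t where "t = map (\<lambda>z. (z, tape_of c0 z)) (reach ps)"
    let ?e = "denote (t, state_of c0, 0)"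
    have "t \<in> set (all_tapes n (reach ps))"
      unfolding t_def by (rule graph_mem_all_tapes) fact
    moreover have "state_of c0 \<in> set [1..<Suc k]"
      using \<open>state_of c0 \<in> {1..k}\<close> by auto
    ultimately have "run ps ?e = ?e"
      using * unfolding acts_trivially_def list_all_iff returns_iff by blast
    have ag: "agree ?D c0 ?e"
      by (simp add: agree_def denote_def t_def content_map_graph c0_def)
    have loc: "agree ?D (run ps c0) ?e" "\<And>z. z \<notin> ?D \<Longrightarrow> tape_of (run ps c0) z = tape_of c0 z"
      using run_local[OF ag _ order_refl] \<open>run ps ?e = ?e\<close> by (auto simp: c0_def)
    have "tape_of (run ps c0) = tape_of c0"
    proof
      fix z
      show "tape_of (run ps c0) z = tape_of c0 z"
        using loc ag by (cases "z \<in> ?D") (auto simp: agree_def)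
    qed
    then have "run ps c0 = c0"
      using loc(1) ag by (simp add: agree_def prod_eq_iff)
    then have "run ps (translate (head_of c) c0) = translate (head_of c) c0"
      by (simp add: run_translate)
    then show "run ps c = c" by (simp add: c0_def translate_to_origin)
  qed
qed

lemma computable_content [computable_intros]:
  assumes "computable a" "computable t" "computable z"
  shows "computable (\<lambda>x. content (a x) (t x) (z x))"
  unfolding content_def
  by (intro computable_intros assms computable_comp[OF assms(3), where f = fst])

lemma computable_sim_exec:
  "computable (\<lambda>x. sim_exec (fst x) (snd x))"
  unfolding sim_exec_def sim_matches_def sim_apply_def by (intro computable_intros)

lemma computable_sim_run [computable_intros]:
  assumes "computable p" "computable c"
  shows "computable (\<lambda>x. sim_run (p x) (c x))"
  unfolding sim_run_def
  by (intro computable_intros assms computable_comp[OF computable_sim_exec, of snd, simplified])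

lemma computable_returns [computable_intros]:
  assumes "computable p" "computable c"
  shows "computable (\<lambda>x. returns (p x) (c x))"
proof -
  have "computable (\<lambda>y. returns (fst y) (snd y))"
    unfolding returns_def by (intro computable_intros)
  from computable_comp[OF this computable_Pair[OF assms]] show ?thesis by simp
qed

lemma computable_reach [computable_intros]:
  assumes "computable p" shows "computable (\<lambda>x. reach (p x))"
  unfolding reach_def offsets_def by (intro computable_intros assms)

lemma computable_all_tapes [computable_intros]:
  assumes "computable C" shows "computable (\<lambda>x. all_tapes n (C x))"
  unfolding all_tapes_def by (intro computable_intros assms)

lemma computable_acts_trivially [computable_intros]:
  assumes "computable p" shows "computable (\<lambda>x. acts_trivially n k (p x))"
proof -
  have "computable (\<lambda>ps. acts_trivially n k ps)"
    unfolding acts_trivially_def by (intro computable_intros)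
  from computable_comp[OF this assms] show ?thesis .
qed

lemma computable_well_formed [computable_intros]:
  assumes "computable p" shows "computable (\<lambda>x. well_formed n k (p x))"
proof -
  have "computable (\<lambda>p. well_formed n k p)"
    unfolding well_formed_def by (intro computable_intros)
  from computable_comp[OF this assms] show ?thesis .
qed

section \<open>Programs and Turing machines\<close>

definition machine :: "nat \<Rightarrow> nat \<Rightarrow> 'd::finite program list \<Rightarrow> 'd config \<Rightarrow> 'd config" where
  "machine n k ps = restrict (run ps) (configs n k)"

text \<open>
  The reach of the product serves both as input and as output window: the local rule extends a
  pattern on the window by zero, runs the programs from the origin and restricts the result to the
  window again.
\<close>

lemma machine_turing:
  fixes ps :: "'d::finite program list"
  assumes n: "n \<ge> 1" and ps: "list_all (well_formed n k) ps"
  shows "machine n k ps \<in> turing_machines n k"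
proof -
  let ?C = "set (reach ps)"
  define init :: "'d tape \<Rightarrow> nat \<Rightarrow> 'd config" where
    "init = (\<lambda>P q. (\<lambda>z. if z \<in> ?C then P z else 0, q, 0))"
  define f where "f = (\<lambda>(P, q). (restrict (tape_of (run ps (init P q))) ?C, snd (run ps (init P q))))"
  have "init P q \<in> configs n k" if "P \<in> patterns n ?C" "q \<in> {1..k}" for P q
    using that n by (auto simp: init_def mem_configs_iff patterns_def PiE_iff)
  then have run_init: "run ps (init P q) \<in> configs n k"
    if "P \<in> patterns n ?C" "q \<in> {1..k}" for P q
    using that run_configs[OF ps] by blast
  have f: "f \<in> patterns n ?C \<times> {1..k} \<rightarrow> patterns n ?C \<times> {1..k} \<times> UNIV"
    using run_init by (auto simp: f_def mem_configs_iff patterns_def mem_Times_iff)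
  have step: "\<forall>(x, q, v) \<in> configs n k.
      let (p', q', u') = f (restrict (shift (- v) x) ?C, q)
      in machine n k ps (x, q, v) = ((\<lambda>u. if u - v \<in> ?C then p' (u - v) else x u), q', v + u')"
  proof clarify
    fix x :: "'d tape" and q v assume c: "(x, q, v) \<in> configs n k"
    define c0 where "c0 = (shift (- v) x, q, 0 :: int ^ 'd)"
    define e where "e = run ps (init (restrict (shift (- v) x) ?C) q)"
    have "agree ?C c0 (init (restrict (shift (- v) x) ?C) q)"
      by (auto simp: agree_def c0_def init_def)
    from run_local[OF this _ order_refl]
    have loc: "agree ?C (run ps c0) e" "\<And>z. z \<notin> ?C \<Longrightarrow> tape_of (run ps c0) z = tape_of c0 z"
      by (auto simp: c0_def e_def)
    have "(x, q, v) = translate v c0"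
      using translate_to_origin[of "(x, q, v)"] by (simp add: c0_def)
    then have "machine n k ps (x, q, v) = translate v (run ps c0)"
      using c by (simp add: machine_def run_translate)
    also have "\<dots> = (\<lambda>u. if u - v \<in> ?C then tape_of e (u - v) else x u, state_of e, v + head_of e)"
      using loc by (auto simp: translate_def agree_def shift_def c0_def add.commute)
    finally show "let (p', q', u') = f (restrict (shift (- v) x) ?C, q)
      in machine n k ps (x, q, v) = ((\<lambda>u. if u - v \<in> ?C then p' (u - v) else x u), q', v + u')"
      by (auto simp: f_def e_def[symmetric] case_prod_unfold Let_def)
  qed
  have "machine n k ps \<in> configs n k \<rightarrow>\<^sub>E configs n k"
    using run_configs[OF ps] by (auto simp: machine_def)
  with f step show ?thesis
    unfolding turing_machines_def
    by (intro CollectI conjI exI[of _ ?C] exI[of _ f] finite_set)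
qed

text \<open>
  There are only finitely many pairs of a pattern on the input window and a state, and each of
  them becomes one rule. Exactly one of these rules matches a given configuration, so their order
  does not matter.
\<close>

lemma turing_machine_program:
  fixes T :: "'d::finite config \<Rightarrow> 'd config"
  assumes "T \<in> turing_machines n k"
  shows "\<exists>p. well_formed n k p \<and> (\<forall>c \<in> configs n k. exec p c = T c)"
proof -
  obtain F_in F_out f where fin: "finite F_in" "finite F_out"
    and f: "f \<in> patterns n F_in \<times> {1..k} \<rightarrow> patterns n F_out \<times> {1..k} \<times> UNIV"
    and T: "\<forall>(x, q, v) \<in> configs n k.
        let (p', q', u') = f (restrict (shift (- v) x) F_in, q)
        in T (x, q, v) = ((\<lambda>u. if u - v \<in> F_out then p' (u - v) else x u), q', v + u')"
    using assms unfolding turing_machines_def mem_Collect_eq by (elim conjE exE)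
  have "finite (patterns n F_in)"
    using fin(1) unfolding patterns_def by (intro finite_PiE) auto
  then obtain Ps where Ps: "set Ps = patterns n F_in" using finite_list by blast
  obtain ins outs where ins: "set ins = F_in" and outs: "set outs = F_out"
    using finite_list[OF fin(1)] finite_list[OF fin(2)] by blast
  define rule where "rule = (\<lambda>P q. (map (\<lambda>z. (z, P z)) ins, q,
    map (\<lambda>z. (z, fst (f (P, q)) z)) outs, snd (f (P, q))))"
  define p where "p = concat (map (\<lambda>P. map (rule P) [1..<Suc k]) Ps)"
  have p: "r \<in> set p \<longleftrightarrow> (\<exists>P \<in> patterns n F_in. \<exists>q \<in> {1..k}. r = rule P q)" for r
    by (auto simp: p_def Ps atLeastLessThanSuc_atLeastAtMost simp del: upt_Suc)
  have f': "fst (f (P, q)) z < n" "fst (snd (f (P, q))) \<in> {1..k}"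
    if "P \<in> patterns n F_in" "q \<in> {1..k}" "z \<in> F_out" for P q z
    using funcset_mem[OF f, of "(P, q)"] that by (auto simp: patterns_def)
  have f'': "fst (snd (f (P, q))) \<in> {1..k}"
    if "P \<in> patterns n F_in" "q \<in> {1..k}" for P q
    using funcset_mem[OF f, of "(P, q)"] that by auto
  have "well_formed n k p"
    unfolding well_formed_def list_all_iff
  proof
    fix r assume "r \<in> set p"
    then obtain P q where P: "P \<in> patterns n F_in" and q: "q \<in> {1..k}" and r: "r = rule P q"
      using p by blast
    show "(\<forall>w \<in> set (writes r). snd w < n) \<and> 1 \<le> target r \<and> target r \<le> k"
      using f'[OF P q] f''[OF P q] by (auto simp: r rule_def outs)
  qed
  moreover have "exec p (x, q, v) = T (x, q, v)" if c: "(x, q, v) \<in> configs n k" for x q v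
  proof -
    let ?P = "restrict (shift (- v) x) F_in"
    have P: "?P \<in> patterns n F_in" and q: "q \<in> {1..k}"
      using c by (auto simp: patterns_def shift_def mem_configs_iff)
    have m: "matches (rule P q') (x, q, v) \<longleftrightarrow> q' = q \<and> P = ?P"
      if "P \<in> patterns n F_in" for P q'
    proof -
      have "matches (rule P q') (x, q, v) \<longleftrightarrow> q' = q \<and> (\<forall>z \<in> F_in. x (v + z) = P z)"
        by (auto simp: matches_def rule_def list_all_iff ins)
      also have "(\<forall>z \<in> F_in. x (v + z) = P z) \<longleftrightarrow> P = ?P"
        using that by (auto simp: patterns_def shift_def PiE_def extensional_def fun_eq_iff
            restrict_def add.commute)
      finally show ?thesis .
    qed
    show ?thesis
    proof (cases rule: exec_cases[of p "(x, q, v)"])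
      case 1
      have "rule ?P q \<in> set p" unfolding p using P q by blast
      then have False using 1(2) m[OF P] by blast
      then show ?thesis ..
    next
      case (2 r)
      then obtain P' q' where "P' \<in> patterns n F_in" "r = rule P' q'" using p by blast
      then have "r = rule ?P q" using 2(2) m by simp
      obtain p' q' u' where fe: "f (?P, q) = (p', q', u')" by (cases "f (?P, q)") auto
      have "exec p (x, q, v) = ((\<lambda>u. if u - v \<in> F_out then p' (u - v) else x u), q', v + u')"
        unfolding 2 \<open>r = rule ?P q\<close>
        by (simp add: apply_rule_def rule_def content_map_graph outs fe)
      also have "\<dots> = T (x, q, v)"
        using bspec[OF T c] by (simp add: Let_def fe)
      finally show ?thesis .
    qed
  qed
  ultimately show ?thesis by (intro exI[of _ p]) auto
qed

section \<open>The generators\<close>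

definition inverse_programs :: "nat \<Rightarrow> nat \<Rightarrow> 'd::finite program \<times> 'd program \<Rightarrow> bool" where
  "inverse_programs n k ab \<longleftrightarrow> well_formed n k (fst ab) \<and> well_formed n k (snd ab) \<and>
    acts_trivially n k [fst ab, snd ab] \<and> acts_trivially n k [snd ab, fst ab]"

text \<open>
  The function \<open>f\<close> decodes a generator to a pair of programs. Pairs that are not inverse to each
  other are replaced by the identity, so that every word acts by reversible machines.
\<close>

definition letter_program ::
  "nat \<Rightarrow> nat \<Rightarrow> (nat \<Rightarrow> 'd::finite program \<times> 'd program) \<Rightarrow> nat \<times> bool \<Rightarrow> 'd program" where
  "letter_program n k f l =
    (if inverse_programs n k (f (fst l))
     then if snd l then fst (f (fst l)) else snd (f (fst l)) else [])"

definition eval_word ::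
  "nat \<Rightarrow> nat \<Rightarrow> (nat \<Rightarrow> 'd::finite program \<times> 'd program) \<Rightarrow> word \<Rightarrow> 'd config \<Rightarrow> 'd config" where
  "eval_word n k f w = machine n k (map (letter_program n k f) w)"

lemma well_formed_letter_program: "well_formed n k (letter_program n k f l)"
  by (auto simp: letter_program_def inverse_programs_def well_formed_def)

lemma well_formed_word: "list_all (well_formed n k) (map (letter_program n k f) w)"
  by (simp add: list_all_iff well_formed_letter_program)

lemma eval_word_eq_iff:
  "eval_word n k f w = eval_word n k f [] \<longleftrightarrow>
    (\<forall>c \<in> configs n k. run (map (letter_program n k f) w) c = c)"
  by (auto simp: eval_word_def machine_def restrict_def fun_eq_iff)

lemma eval_word_cancel:
  assumes "n \<ge> 1"
  shows "eval_word n k f [(s, b), (s, \<not> b)] = eval_word n k f []"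
proof (cases "inverse_programs n k (f s)")
  case True
  then show ?thesis
    unfolding eval_word_eq_iff using assms
    by (cases b) (simp_all add: letter_program_def inverse_programs_def acts_trivially_iff)
next
  case False
  then show ?thesis
    unfolding eval_word_eq_iff by (simp add: letter_program_def)
qed

lemma eval_word_append:
  "compose (configs n k) (eval_word n k f u) (eval_word n k f v) = eval_word n k f (u @ v)"
  using run_configs[OF well_formed_word[of n k f v]]
  by (auto simp: compose_def eval_word_def machine_def restrict_def fun_eq_iff run_append)

section \<open>Presentations from evaluation maps\<close>

definition inverse_word :: "word \<Rightarrow> word" where
  "inverse_word w = rev (map (\<lambda>(s, b). (s, \<not> b)) w)"

lemma inverse_word_Cons: "inverse_word ((s, b) # w) = inverse_word w @ [(s, \<not> b)]"
  by (simp add: inverse_word_def)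

text \<open>
  The fibres of an evaluation form a congruence that respects free cancellation. Every value is
  therefore invertible, which is how words are seen to act by reversible machines.
\<close>

locale evaluation =
  fixes ev :: "word \<Rightarrow> 'g"
  assumes ev_append_cong: "ev u = ev u' \<Longrightarrow> ev v = ev v' \<Longrightarrow> ev (u @ v) = ev (u' @ v')"
    and ev_cancel: "ev [(s, b), (s, \<not> b)] = ev []"
begin

definition kernel :: "word set" where
  "kernel = {w. ev w = ev []}"

lemma ev_delete: "ev w = ev [] \<Longrightarrow> ev (u @ w @ v) = ev (u @ v)"
  using ev_append_cong[of u u "w @ v" v] ev_append_cong[of w "[]" v v] by simp

lemma ev_inverse_word: "ev (w @ inverse_word w) = ev []" "ev (inverse_word w @ w) = ev []"
proof (induction w)
  case (Cons l w)
  obtain s b where l: "l = (s, b)" by fastforce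
  {
    case 1
    have "ev ([(s, b)] @ (w @ inverse_word w) @ [(s, \<not> b)]) = ev ([(s, b)] @ [(s, \<not> b)])"
      by (rule ev_delete[OF Cons(1)])
    then show ?case by (simp add: l inverse_word_Cons ev_cancel)
  next
    case 2
    have "ev (inverse_word w @ [(s, \<not> b), (s, \<not> \<not> b)] @ w) = ev (inverse_word w @ w)"
      by (rule ev_delete[OF ev_cancel])
    then show ?case by (simp add: l inverse_word_Cons Cons(2))
  }
qed (simp_all add: inverse_word_def)

text \<open>
  If \<open>u\<close> and \<open>v\<close> have the same value, then \<open>v\<^sup>-\<^sup>1 v\<close> and \<open>u v\<^sup>-\<^sup>1\<close> are relators, and
  deleting either of them from \<open>u v\<^sup>-\<^sup>1 v\<close> leaves \<open>u\<close> or \<open>v\<close>.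
\<close>

lemma pres_rel_kernel: "pres_rel UNIV kernel = {(u, v). ev u = ev v}"
proof (intro equalityI subsetI)
  fix p assume "p \<in> pres_rel UNIV kernel"
  moreover obtain u v where "p = (u, v)" by fastforce
  ultimately have "(u, v) \<in> pres_rel UNIV kernel" by simp
  then have "ev u = ev v"
  proof (induction rule: pres_rel.induct)
    case (cancel u v s b)
    then show ?case using ev_delete[OF ev_cancel] by simp
  next
    case (relator u v r)
    then show ?case using ev_delete by (simp add: kernel_def)
  qed auto
  with \<open>p = (u, v)\<close> show "p \<in> {(u, v). ev u = ev v}" by simp
next
  fix p assume "p \<in> {(u, v). ev u = ev v}"
  then obtain u v where p: "p = (u, v)" and uv: "ev u = ev v" by blast
  \<comment> \<open>\<open>u v\<^sup>-\<^sup>1 v\<close> is equivalent to \<open>u\<close> and to \<open>v\<close>\<close>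
  have "inverse_word v @ v \<in> kernel" by (simp add: kernel_def ev_inverse_word)
  from pres_rel.relator[OF _ _ this, of u UNIV "[]"]
  have 1: "(u @ inverse_word v @ v, u) \<in> pres_rel UNIV kernel" by (simp add: words_def)
  have "ev (u @ inverse_word v) = ev (v @ inverse_word v)" by (rule ev_append_cong[OF uv HOL.refl])
  then have "u @ inverse_word v \<in> kernel" by (simp add: kernel_def ev_inverse_word)
  from pres_rel.relator[OF _ _ this, of "[]" UNIV v]
  have 2: "(u @ inverse_word v @ v, v) \<in> pres_rel UNIV kernel" by (simp add: words_def)
  show "p \<in> pres_rel UNIV kernel"
    unfolding p by (rule pres_rel.trans[OF pres_rel.sym[OF 1] 2])
qed

lemma presented_group_kernel:
  fixes G (structure)
  assumes ev_append: "\<And>u v. ev (u @ v) = ev u \<otimes> ev v" and range_ev: "range ev = carrier G"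
  shows "presented_group UNIV kernel \<cong> G"
proof -
  let ?P = "presented_group UNIV kernel"
  define cls where "cls = (\<lambda>u. {v. ev u = ev v})"
  have image: "pres_rel UNIV kernel `` {u} = cls u" for u
    by (auto simp: pres_rel_kernel cls_def)
  have carrier: "carrier ?P = range cls"
    by (auto simp: presented_group_def quotient_def image words_def)
  have "mult ?P (cls u) (cls v) = cls (u @ v)" for u v
    unfolding presented_group_def monoid.simps image by (auto simp: cls_def ev_append)
  moreover define h where "h = (\<lambda>A. the_elem (ev ` A))"
  moreover have "h (cls u) = ev u" for u
  proof -
    have "ev ` cls u = {ev u}" by (auto simp: cls_def)
    then show ?thesis by (simp add: h_def)
  qed
  ultimately have "h \<in> hom ?P G"
    using range_ev by (auto simp: hom_def carrier ev_append)
  moreover have "bij_betw h (carrier ?P) (carrier G)"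
    unfolding carrier range_ev[symmetric]
    using \<open>\<And>u. h (cls u) = ev u\<close> by (auto simp: bij_betw_def inj_on_def image_iff) (auto simp: cls_def)
  ultimately show ?thesis by (auto intro: is_isoI isoI)
qed

lemma word_problem_kernel: "word_problem UNIV kernel = kernel"
proof -
  have "w \<in> word_problem UNIV kernel \<longleftrightarrow> {v. ev w = ev v} = {v. ev [] = ev v}" for w
    by (auto simp: word_problem_def presented_group_def words_def pres_rel_kernel Image_def)
  also have "\<dots> w \<longleftrightarrow> w \<in> kernel" for w
    by (auto simp: kernel_def)
  finally show ?thesis by blast
qed

lemma recursive_presentation_kernel:
  assumes "recursive_set (word_code ` kernel)"
  shows "recursive_presentation UNIV kernel" "decidable_word_problem UNIV kernel"
proof -
  have "re_set UNIV"
    unfolding re_set_def using recursive_fn.proj[of 0 1] by (intro disjI2 exI[of _ "\<lambda>xs. xs ! 0"]) auto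
  then show "recursive_presentation UNIV kernel"
    using re_set_recursive_set[OF assms] by (auto simp: recursive_presentation_def words_def)
  show "decidable_word_problem UNIV kernel"
    using assms by (simp add: decidable_word_problem_def word_problem_kernel)
qed

end

section \<open>The group of reversible machines\<close>

lemma reversible_machines_Bij: "reversible_machines n k \<subseteq> Bij (configs n k)"
proof
  fix T :: "'d::finite config \<Rightarrow> 'd config"
  assume "T \<in> reversible_machines n k"
  then obtain T' where T: "T \<in> configs n k \<rightarrow>\<^sub>E configs n k" and T': "T' \<in> configs n k \<rightarrow>\<^sub>E configs n k"
    and eq: "compose (configs n k) T T' = (\<lambda>c \<in> configs n k. c)"
      "compose (configs n k) T' T = (\<lambda>c \<in> configs n k. c)"
    unfolding reversible_machines_def turing_machines_def by blast
  have "T (T' c) = c" "T' (T c) = c" if "c \<in> configs n k" for c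
    using fun_cong[OF eq(1), of c] fun_cong[OF eq(2), of c] that by (simp_all add: compose_def)
  then have "bij_betw T (configs n k) (configs n k)"
    using T T' by (intro bij_betw_byWitness[of _ T']) auto
  then show "T \<in> Bij (configs n k)" using T by (simp add: Bij_def PiE_def)
qed

lemma evaluation_eval_word: "n \<ge> 1 \<Longrightarrow> evaluation (eval_word n k f)"
  by standard (metis eval_word_append, rule eval_word_cancel)

lemma eval_word_reversible:
  assumes n: "n \<ge> 1"
  shows "eval_word n k f w \<in> reversible_machines n k"
proof -
  interpret evaluation "eval_word n k f" by (rule evaluation_eval_word[OF n])
  have "eval_word n k f u \<in> turing_machines n k" for u
    unfolding eval_word_def by (rule machine_turing[OF n well_formed_word])
  moreover have "eval_word n k f [] = (\<lambda>c \<in> configs n k. c)"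
    by (auto simp: eval_word_def machine_def restrict_def)
  ultimately show ?thesis
    unfolding reversible_machines_def
    by (intro CollectI conjI bexI[of _ "eval_word n k f (inverse_word w)"])
      (simp_all add: eval_word_append ev_inverse_word)
qed

text \<open>
  Programs for a machine and for its inverse form a pair whose code is a generator that
  evaluates to the machine.
\<close>

lemma reversible_machine_eval_word:
  fixes T :: "'d::finite config \<Rightarrow> 'd config"
  assumes n: "n \<ge> 1" and f: "\<And>ab. f (code ab) = ab" and "T \<in> reversible_machines n k"
  shows "T \<in> range (eval_word n k f)"
proof -
  obtain T' where T: "T \<in> turing_machines n k" "T' \<in> turing_machines n k"
    and eq: "compose (configs n k) T T' = (\<lambda>c \<in> configs n k. c)" "compose (configs n k) T' T = (\<lambda>c \<in> configs n k. c)"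
    using assms(3) by (auto simp: reversible_machines_def)
  obtain a b where ab: "well_formed n k a" "\<And>c. c \<in> configs n k \<Longrightarrow> exec a c = T c"
    "well_formed n k b" "\<And>c. c \<in> configs n k \<Longrightarrow> exec b c = T' c"
    using turing_machine_program[OF T(1)] turing_machine_program[OF T(2)] by blast
  have in_S: "T c \<in> configs n k" "T' c \<in> configs n k" if "c \<in> configs n k" for c
    using T that by (auto simp: turing_machines_def)
  have "T (T' c) = c" "T' (T c) = c" if "c \<in> configs n k" for c
    using fun_cong[OF eq(1), of c] fun_cong[OF eq(2), of c] that by (simp_all add: compose_def)
  then have "inverse_programs n k (a, b)"
    using ab in_S by (simp add: inverse_programs_def acts_trivially_iff[OF n])
  then have "eval_word n k f [(code (a, b), True)] = restrict (exec a) (configs n k)"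
    by (auto simp: eval_word_def machine_def letter_program_def f)
  also have "\<dots> = T"
    using T(1) ab(2) by (auto simp: turing_machines_def PiE_def extensional_def restrict_def)
  finally show ?thesis by blast
qed

lemma carrier_RTM: "carrier (RTM TYPE('d::finite) n k) = reversible_machines n k"
  by (simp add: RTM_def)

lemma mult_RTM:
  assumes "T \<in> reversible_machines n k" "U \<in> reversible_machines n k"
  shows "T \<otimes>\<^bsub>RTM TYPE('d::finite) n k\<^esub> U = compose (configs n k) T U"
  using assms reversible_machines_Bij by (auto simp: RTM_def BijGroup_def subset_iff)

lemma decoder_program_pairs: "\<exists>f :: nat \<Rightarrow> 'd::finite program \<times> 'd program. decoder f"
proof -
  obtain v :: "nat \<Rightarrow> int ^ 'd" where v: "decoder v" using decoder_vec[OF decoder_int] by blast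
  note cells = decoder_list[OF decoder_prod[OF v decoder_nat]]
  note rules = decoder_prod[OF cells decoder_prod[OF decoder_nat
        decoder_prod[OF cells decoder_prod[OF decoder_nat v]]]]
  show ?thesis
    using decoder_prod[OF decoder_list[OF rules] decoder_list[OF rules]] by blast
qed

lemma computable_letter_program [computable_intros]:
  fixes f :: "nat \<Rightarrow> 'd::finite program \<times> 'd program"
  assumes "decoder f" "computable l"
  shows "computable (\<lambda>x. letter_program n k f (l x))"
proof -
  have f: "computable (\<lambda>x. f (fst (l x)))"
    by (rule computable_comp[OF _ computable_fst[OF assms(2)]])
      (use assms(1) in \<open>simp add: decoder_def\<close>)
  show ?thesis
    unfolding letter_program_def inverse_programs_def
    by (intro computable_intros assms f)
qed

lemma recursive_trivial_words:
  fixes f :: "nat \<Rightarrow> 'd::finite program \<times> 'd program"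
  assumes n: "n \<ge> 1" and f: "decoder f"
  shows "recursive_set (word_code ` {w. eval_word n k f w = eval_word n k f []})"
proof -
  have "computable (\<lambda>w. acts_trivially n k (map (letter_program n k f) w))"
    by (intro computable_intros f)
  moreover have "acts_trivially n k (map (letter_program n k f) w) \<longleftrightarrow>
      eval_word n k f w = eval_word n k f []" for w
    by (simp add: eval_word_eq_iff acts_trivially_iff[OF n])
  ultimately have "recursive_set (code ` {w. eval_word n k f w = eval_word n k f []})"
    using recursive_set_image_code[OF _ decoder_list[OF decoder_prod[OF decoder_nat decoder_bool]]]
    by simp
  moreover have "code w = word_code w" for w :: word
    unfolding word_code_def code_list_def
    by (intro arg_cong[where f = list_encode] map_cong)
      (auto simp: code_prod_def code_nat_def code_bool_def)
  ultimately show ?thesis by simp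
qed

theorem proposition4p2:
  fixes n k :: nat
  assumes "n \<ge> 1" and "k \<ge> 1"
  shows "\<exists>S R. recursive_presentation S R \<and> decidable_word_problem S R \<and>
    presented_group S R \<cong> RTM TYPE('d::finite) n k"
proof -
  obtain f :: "nat \<Rightarrow> 'd program \<times> 'd program" where f: "decoder f"
    using decoder_program_pairs by blast
  then have inv: "f (code ab) = ab" for ab unfolding decoder_def by blast
  interpret evaluation "eval_word n k f" by (rule evaluation_eval_word[OF \<open>n \<ge> 1\<close>])
  have "recursive_set (word_code ` kernel)"
    using recursive_trivial_words[OF \<open>n \<ge> 1\<close> f] by (simp add: kernel_def)
  note pres = recursive_presentation_kernel[OF this]
  have "presented_group UNIV kernel \<cong> RTM TYPE('d) n k"
  proof (rule presented_group_kernel)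
    show "eval_word n k f (u @ v) = eval_word n k f u \<otimes>\<^bsub>RTM TYPE('d) n k\<^esub> eval_word n k f v"
      for u v
      by (simp add: mult_RTM eval_word_reversible[OF \<open>n \<ge> 1\<close>] eval_word_append)
    show "range (eval_word n k f) = carrier (RTM TYPE('d) n k)"
      unfolding carrier_RTM
      using eval_word_reversible[OF \<open>n \<ge> 1\<close>] reversible_machine_eval_word[OF \<open>n \<ge> 1\<close> inv] by blast
  qed
  with pres show ?thesis by blast
qed

end
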